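(* Let $\mathcal{H}$ be a real Hilbert space, let $D$ be a nonempty closed convex subset of $\mathcal{H}$, let $m\geq 2$ be an integer, let $I=\{1,\ldots,m\}$, and let $(T_i)_{i\in I}$ be a family of nonexpansive operators from $D$ to $D$. Set $T=\frac1m\sum_{i\in I}T_i$ and, for every $\varepsilon\in\,]0,1[$, $$R^{\varepsilon}=\big(\operatorname{Id}+\varepsilon(T_m-\operatorname{Id})\big)\circ\cdots\circ\big(\operatorname{Id}+\varepsilon(T_1-\operatorname{Id})\big).$$ Suppose that there exist $\eta\in\,]0,1]$ and $\beta\in\,]0,+\infty[$ such that for every $\varepsilon\in\,]0,\eta[$ there exists $z^{\varepsilon}\in\operatorname{Fix}R^{\varepsilon}$ with $\|z^{\varepsilon}\|\leq\beta$. Let $y_0\in D$ and let $x$ be the solution of the Cauchy problem $$x'(t)=-(\operatorname{Id}-T)x(t)\ \text{ on }\ ]0,+\infty[,\qquad x(0)=y_0.$$ For every $\varepsilon\in\,]0,\eta[$, set $(z_k^{\varepsilon})_{k\in\mathbb{N}}=((R^{\varepsilon})^ky_0)_{k\in\mathbb{N}}$ and let $\psi^{\varepsilon}\colon[0,+\infty[\,\to\mathcal{H}$ be the linear interpolation given by $$(\forall k\in\mathbb{N})(\forall t\in[km\varepsilon,(k+1)m\varepsilon[)\quad \psi^{\varepsilon}(t)=z_k^{\varepsilon}+\frac{t-km\varepsilon}{m\varepsilon}(z_{k+1}^{\varepsilon}-z_k^{\varepsilon}).$$ Then, for every $\bar t\in\,]0,+\infty[$, $\sup_{0\leq t\leq\bar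 t}\|\psi^{\varepsilon}(t)-x(t)\|\to0$ as $\varepsilon\to0$.
   Context: Nonexpansive means $1$-Lipschitz for the norm of $\mathcal{H}$. $\operatorname{Id}$ is the identity operator and $\operatorname{Fix}$ denotes the set of fixed points. It is a known fact that, since $\operatorname{Id}-T$ is Lipschitz and $y_0\in D$, the Cauchy problem has a unique solution (continuous on $[0,+\infty[$, continuously differentiable on $]0,+\infty[$, and with values in $D$). *)

theory Defs
  imports "HOL-Analysis.Analysis"
begin

(* Operators from D to D are total functions of which only the values on D matter;
   fixed points are accordingly sought in D. *)
definition Fix_on :: "'a set \<Rightarrow> ('a \<Rightarrow> 'a) \<Rightarrow> 'a set" where
  "Fix_on D F = {x \<in> D. F x = x}"

definition average_op :: "nat \<Rightarrow> (nat \<Rightarrow> 'a \<Rightarrow> 'a) \<Rightarrow> 'a \<Rightarrow> 'a::real_vector" where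
  "average_op m T x = (1 / real m) *\<^sub>R (\<Sum>i = 1..m. T i x)"

definition relaxed_op :: "real \<Rightarrow> ('a \<Rightarrow> 'a) \<Rightarrow> 'a \<Rightarrow> 'a::real_vector" where
  "relaxed_op \<epsilon> F x = x + \<epsilon> *\<^sub>R (F x - x)"

(* The list is traversed from left to right, so T 1 is applied first and T m last. *)
definition cyclic_op :: "nat \<Rightarrow> (nat \<Rightarrow> 'a \<Rightarrow> 'a) \<Rightarrow> real \<Rightarrow> 'a \<Rightarrow> 'a::real_vector" where
  "cyclic_op m T \<epsilon> = fold (\<lambda>i. relaxed_op \<epsilon> (T i)) [1..<Suc m]"

(* Only the restriction of x to the nonnegative reals matters. The derivative on the positive
   reals is given by the equation, so for nonexpansive F its continuity is automatic. *)
definition cauchy_solution ::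
  "'a set \<Rightarrow> ('a \<Rightarrow> 'a) \<Rightarrow> 'a \<Rightarrow> (real \<Rightarrow> 'a::real_normed_vector) \<Rightarrow> bool" where
  "cauchy_solution D F y0 x \<longleftrightarrow>
     continuous_on {0..} x \<and> (\<forall>t\<ge>0. x t \<in> D) \<and> x 0 = y0 \<and>
     (\<forall>t>0. (x has_vector_derivative - (x t - F (x t))) (at t))"

end

theory Submission
  imports Defs
begin

text \<open>
  The composition \<open>R\<^sup>\<epsilon> = cyclic_op m T \<epsilon>\<close> is one step, of length \<open>h = m\<epsilon>\<close>, of a splitting scheme for
  \<open>x' = -(x - F x)\<close> with \<open>F = average_op m T\<close>, and the theorem is an instance of the principle that a
  consistent and stable one-step scheme converges.

  Stability is immediate: relaxations and compositions of nonexpansive maps are nonexpansive, so one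
  step never increases the distance between two points of \<open>D\<close> (\<open>nonexpansive_fold_relaxed\<close>).

  For consistency it suffices to insert the exact solution in the scheme. On a compact time
  interval the solution is continuous, so all displacements \<open>T i (x t) - x t\<close> are bounded there by some
  \<open>K\<close>. The partial compositions inside \<open>R\<^sup>\<epsilon>\<close> then drift from \<open>x t\<close> by \<open>O(\<epsilon>)\<close>, and each residual
  \<open>T i - Id\<close> is 2-Lipschitz, so that \<open>R\<^sup>\<epsilon> (x t)\<close> agrees with the Euler step \<open>x t + h (F (x t) - x t)\<close> up to
  \<open>K h\<^sup>2\<close> (\<open>cyclic_op_euler_error\<close>). The same bound \<open>K\<close> is a Lipschitz constant for \<open>x\<close>, so that the flow
  agrees with the Euler step up to \<open>2 K h\<^sup>2\<close> (\<open>solution_euler_error\<close>).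

  Stability lets the local errors \<open>3 K h\<^sup>2\<close> merely add up: after \<open>k\<close> steps the distance between the
  iterate and \<open>x (k h)\<close> is at most \<open>3 K h (k h)\<close> (\<open>iterate_error\<close>). Interpolation costs another
  \<open>K h\<close>, and the resulting bound is of order \<open>\<epsilon>\<close>, uniformly on the time interval.
\<close>

section \<open>Relaxations and their compositions\<close>

lemma nonexpansiveD:
  assumes "1-lipschitz_on D F" "u \<in> D" "v \<in> D"
  shows "norm (F u - F v) \<le> norm (u - v)"
  using lipschitz_onD[OF assms] by (simp add: dist_norm)

lemma norm_residual_diff_le:
  assumes "1-lipschitz_on D F" "u \<in> D" "v \<in> D"
  shows "norm ((F u - u) - (F v - v)) \<le> 2 * norm (u - v)"
proof -
  have "norm ((F u - u) - (F v - v)) = norm ((F u - F v) - (u - v))"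
    by (simp add: algebra_simps)
  also have "\<dots> \<le> norm (F u - F v) + norm (u - v)"
    by (rule norm_triangle_ineq4)
  finally show ?thesis
    using nonexpansiveD[OF assms] by simp
qed

lemma relaxed_op_mem:
  assumes "convex D" "F ` D \<subseteq> D" "0 \<le> \<epsilon>" "\<epsilon> \<le> 1" "v \<in> D"
  shows "relaxed_op \<epsilon> F v \<in> D"
proof -
  have "(1 - \<epsilon>) *\<^sub>R v + \<epsilon> *\<^sub>R F v \<in> D"
    using assms by (intro convexD) auto
  then show ?thesis
    by (simp add: relaxed_op_def algebra_simps)
qed

lemma nonexpansive_relaxed_op:
  fixes F :: "'a \<Rightarrow> 'a::real_normed_vector"
  assumes "1-lipschitz_on D F" "0 \<le> \<epsilon>" "\<epsilon> \<le> 1"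
  shows "1-lipschitz_on D (relaxed_op \<epsilon> F)"
proof (rule lipschitz_onI)
  fix u v assume uv: "u \<in> D" "v \<in> D"
  have "relaxed_op \<epsilon> F u - relaxed_op \<epsilon> F v = (1 - \<epsilon>) *\<^sub>R (u - v) + \<epsilon> *\<^sub>R (F u - F v)"
    by (simp add: relaxed_op_def algebra_simps)
  then have "norm (relaxed_op \<epsilon> F u - relaxed_op \<epsilon> F v)
      \<le> norm ((1 - \<epsilon>) *\<^sub>R (u - v)) + norm (\<epsilon> *\<^sub>R (F u - F v))"
    by (metis norm_triangle_ineq)
  also have "\<dots> = (1 - \<epsilon>) * norm (u - v) + \<epsilon> * norm (F u - F v)"
    using assms by simp
  also have "\<dots> \<le> (1 - \<epsilon>) * norm (u - v) + \<epsilon> * norm (u - v)"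
    using nonexpansiveD[OF assms(1) uv] assms(2) by (intro add_left_mono mult_left_mono)
  finally show "dist (relaxed_op \<epsilon> F u) (relaxed_op \<epsilon> F v) \<le> 1 * dist u v"
    by (simp add: dist_norm algebra_simps)
qed simp

lemma fold_relaxed_mem:
  assumes "convex D" "\<And>i. i \<in> set is \<Longrightarrow> T i ` D \<subseteq> D" "0 \<le> \<epsilon>" "\<epsilon> \<le> 1" "v \<in> D"
  shows "fold (\<lambda>i. relaxed_op \<epsilon> (T i)) is v \<in> D"
  using assms(2)
proof (induction "is" rule: rev_induct)
  case Nil
  show ?case using assms(5) by simp
next
  case (snoc i "is")
  then show ?case
    using relaxed_op_mem[OF assms(1) _ assms(3,4)] by simp
qed

lemma nonexpansive_fold_relaxed:
  fixes T :: "'i \<Rightarrow> 'a \<Rightarrow> 'a::real_normed_vector"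
  assumes "convex D" "\<And>i. i \<in> set is \<Longrightarrow> T i ` D \<subseteq> D"
    and "\<And>i. i \<in> set is \<Longrightarrow> 1-lipschitz_on D (T i)" "0 \<le> \<epsilon>" "\<epsilon> \<le> 1"
  shows "1-lipschitz_on D (fold (\<lambda>i. relaxed_op \<epsilon> (T i)) is)"
  using assms(2,3)
proof (induction "is" rule: rev_induct)
  case Nil
  show ?case by (auto intro!: lipschitz_onI)
next
  case (snoc i "is")
  show ?case
  proof (rule lipschitz_onI)
    fix u v assume uv: "u \<in> D" "v \<in> D"
    let ?R = "fold (\<lambda>i. relaxed_op \<epsilon> (T i)) is"
    have mem: "?R u \<in> D" "?R v \<in> D"
      using snoc.prems(1) uv by (simp_all add: fold_relaxed_mem[OF assms(1) _ assms(4,5)])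
    have step: "1-lipschitz_on D (relaxed_op \<epsilon> (T i))"
      using snoc.prems(2) assms(4,5) by (intro nonexpansive_relaxed_op) auto
    have IH: "1-lipschitz_on D ?R"
      using snoc by auto
    show "dist (fold (\<lambda>i. relaxed_op \<epsilon> (T i)) (is @ [i]) u)
        (fold (\<lambda>i. relaxed_op \<epsilon> (T i)) (is @ [i]) v) \<le> 1 * dist u v"
      using lipschitz_onD[OF step mem] lipschitz_onD[OF IH uv] by simp
  qed simp
qed

section \<open>Comparison with an Euler step\<close>

text \<open>
  A relaxation, being nonexpansive, increases the distance of a point from \<open>v\<close> by no more than its
  displacement of \<open>v\<close> itself. The drift of a composition is therefore controlled by displacements at the starting point
  only.
\<close>

lemma fold_relaxed_drift:
  fixes T :: "'i \<Rightarrow> 'a \<Rightarrow> 'a::real_normed_vector"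
  assumes "convex D" "\<And>i. i \<in> set is \<Longrightarrow> T i ` D \<subseteq> D"
    and "\<And>i. i \<in> set is \<Longrightarrow> 1-lipschitz_on D (T i)" "0 \<le> \<epsilon>" "\<epsilon> \<le> 1" "v \<in> D"
    and "\<And>i. i \<in> set is \<Longrightarrow> norm (T i v - v) \<le> K"
  shows "norm (fold (\<lambda>i. relaxed_op \<epsilon> (T i)) is v - v) \<le> real (length is) * \<epsilon> * K"
  using assms(2,3,7)
proof (induction "is" rule: rev_induct)
  case Nil
  show ?case by simp
next
  case (snoc i "is")
  let ?w = "fold (\<lambda>i. relaxed_op \<epsilon> (T i)) is v"
  have w: "?w \<in> D"
    using snoc.prems(1) by (intro fold_relaxed_mem[OF assms(1) _ assms(4-6)]) simp
  have "1-lipschitz_on D (relaxed_op \<epsilon> (T i))"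
    using snoc.prems(2) assms(4,5) by (intro nonexpansive_relaxed_op) auto
  then have "norm (relaxed_op \<epsilon> (T i) ?w - relaxed_op \<epsilon> (T i) v) \<le> norm (?w - v)"
    using w assms(6) by (rule nonexpansiveD)
  moreover have "norm (relaxed_op \<epsilon> (T i) v - v) \<le> \<epsilon> * K"
    using snoc.prems(3) assms(4) by (auto simp: relaxed_op_def intro!: mult_left_mono)
  moreover have "norm (?w - v) \<le> real (length is) * \<epsilon> * K"
    using snoc by simp
  moreover have "norm (relaxed_op \<epsilon> (T i) ?w - v)
      \<le> norm (relaxed_op \<epsilon> (T i) ?w - relaxed_op \<epsilon> (T i) v) + norm (relaxed_op \<epsilon> (T i) v - v)"
    by (metis norm_triangle_ineq diff_add_cancel add_diff_eq)
  ultimately show ?case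
    by (simp add: algebra_simps)
qed

text \<open>
  The factor applied after \<open>j\<close> others acts at a point that has drifted by \<open>j \<epsilon> K\<close>, so replacing this
  point by \<open>v\<close> changes the residual by at most \<open>2 j \<epsilon> K\<close>. These changes, each weighted by
  \<open>\<epsilon>\<close>, add up to \<open>n (n - 1) \<epsilon>\<^sup>2 K\<close> for \<open>n\<close> factors; the rounder bound \<open>n\<^sup>2 \<epsilon>\<^sup>2 K\<close> becomes the square of the
  step length.
\<close>

lemma fold_relaxed_euler_error:
  fixes T :: "'i \<Rightarrow> 'a \<Rightarrow> 'a::real_normed_vector"
  assumes "convex D" "\<And>i. i \<in> set is \<Longrightarrow> T i ` D \<subseteq> D"
    and "\<And>i. i \<in> set is \<Longrightarrow> 1-lipschitz_on D (T i)" "0 \<le> \<epsilon>" "\<epsilon> \<le> 1" "v \<in> D"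
    and "\<And>i. i \<in> set is \<Longrightarrow> norm (T i v - v) \<le> K" "0 \<le> K"
  shows "norm (fold (\<lambda>i. relaxed_op \<epsilon> (T i)) is v - v - \<epsilon> *\<^sub>R (\<Sum>i\<leftarrow>is. T i v - v))
    \<le> (real (length is) * \<epsilon>)\<^sup>2 * K"
  using assms(2,3,7)
proof (induction "is" rule: rev_induct)
  case Nil
  show ?case by simp
next
  case (snoc i "is")
  let ?w = "fold (\<lambda>i. relaxed_op \<epsilon> (T i)) is v" and ?n = "real (length is)"
  let ?S = "\<Sum>i\<leftarrow>is. T i v - v"
  have w: "?w \<in> D"
    using snoc.prems(1) by (intro fold_relaxed_mem[OF assms(1) _ assms(4-6)]) simp
  have drift: "norm (?w - v) \<le> ?n * \<epsilon> * K"
    using snoc.prems by (intro fold_relaxed_drift[OF assms(1) _ _ assms(4-6)]) auto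
  have "norm ((T i ?w - ?w) - (T i v - v)) \<le> 2 * norm (?w - v)"
    using snoc.prems(2) w assms(6) by (intro norm_residual_diff_le) auto
  also have "\<dots> \<le> 2 * (?n * \<epsilon> * K)"
    using drift by simp
  finally have res: "norm (\<epsilon> *\<^sub>R ((T i ?w - ?w) - (T i v - v))) \<le> \<epsilon> * (2 * (?n * \<epsilon> * K))"
    using assms(4) by (simp add: mult_left_mono)
  have "relaxed_op \<epsilon> (T i) ?w - v - \<epsilon> *\<^sub>R (?S + (T i v - v))
      = (?w - v - \<epsilon> *\<^sub>R ?S) + \<epsilon> *\<^sub>R ((T i ?w - ?w) - (T i v - v))"
    by (simp add: relaxed_op_def algebra_simps)
  then have "norm (relaxed_op \<epsilon> (T i) ?w - v - \<epsilon> *\<^sub>R (?S + (T i v - v)))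
      \<le> norm (?w - v - \<epsilon> *\<^sub>R ?S) + norm (\<epsilon> *\<^sub>R ((T i ?w - ?w) - (T i v - v)))"
    by (metis norm_triangle_ineq)
  also have "\<dots> \<le> (?n * \<epsilon>)\<^sup>2 * K + \<epsilon> * (2 * (?n * \<epsilon> * K))"
    using snoc res by (intro add_mono) auto
  also have "\<dots> \<le> ((?n + 1) * \<epsilon>)\<^sup>2 * K"
    using assms(8) by (simp add: power2_eq_square algebra_simps)
  finally show ?case
    by (simp add: add.commute)
qed

lemma average_op_residual:
  assumes "m > 0"
  shows "real m *\<^sub>R (average_op m T v - v) = (\<Sum>i = 1..m. T i v - v)"
  using assms by (simp add: average_op_def sum_subtractf scaleR_right_diff_distrib sum_constant_scaleR)

lemma cyclic_op_euler_error:
  fixes T :: "nat \<Rightarrow> 'a \<Rightarrow> 'a::real_normed_vector"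
  assumes "convex D" "\<And>i. i \<in> {1..m} \<Longrightarrow> T i ` D \<subseteq> D"
    and "\<And>i. i \<in> {1..m} \<Longrightarrow> 1-lipschitz_on D (T i)" "0 \<le> \<epsilon>" "\<epsilon> \<le> 1" "v \<in> D" "m > 0"
    and "\<And>i. i \<in> {1..m} \<Longrightarrow> norm (T i v - v) \<le> K" "0 \<le> K"
  shows "norm (cyclic_op m T \<epsilon> v - v - (real m * \<epsilon>) *\<^sub>R (average_op m T v - v))
    \<le> (real m * \<epsilon>)\<^sup>2 * K"
proof -
  have is_set: "set [1..<Suc m] = {1..m}"
    by auto
  have "(\<Sum>i\<leftarrow>[1..<Suc m]. T i v - v) = (\<Sum>i = 1..m. T i v - v)"
    unfolding is_set[symmetric] by (rule sum_list_distinct_conv_sum_set) simp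
  then have "\<epsilon> *\<^sub>R (\<Sum>i\<leftarrow>[1..<Suc m]. T i v - v) = (real m * \<epsilon>) *\<^sub>R (average_op m T v - v)"
    using average_op_residual[OF assms(7), of T v] by (simp add: mult.commute flip: scaleR_scaleR)
  moreover have "norm (fold (\<lambda>i. relaxed_op \<epsilon> (T i)) [1..<Suc m] v - v
      - \<epsilon> *\<^sub>R (\<Sum>i\<leftarrow>[1..<Suc m]. T i v - v)) \<le> (real (length [1..<Suc m]) * \<epsilon>)\<^sup>2 * K"
    by (rule fold_relaxed_euler_error[OF assms(1) _ _ assms(4-6) _ assms(9)])
      (rule assms(2,3,8), simp only: is_set)+
  ultimately show ?thesis
    by (simp add: cyclic_op_def del: upt_Suc)
qed

lemma nonexpansive_average_op:
  fixes T :: "nat \<Rightarrow> 'a \<Rightarrow> 'a::real_normed_vector"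
  assumes "\<And>i. i \<in> {1..m} \<Longrightarrow> 1-lipschitz_on D (T i)"
  shows "1-lipschitz_on D (average_op m T)"
proof (rule lipschitz_onI)
  fix u v assume uv: "u \<in> D" "v \<in> D"
  have "average_op m T u - average_op m T v = (1 / real m) *\<^sub>R (\<Sum>i = 1..m. T i u - T i v)"
    by (simp add: average_op_def sum_subtractf scaleR_right_diff_distrib)
  then have "norm (average_op m T u - average_op m T v)
      = (1 / real m) * norm (\<Sum>i = 1..m. T i u - T i v)"
    by simp
  also have "\<dots> \<le> (1 / real m) * (\<Sum>i = 1..m. norm (u - v))"
    by (intro mult_left_mono order_trans[OF norm_sum] sum_mono nonexpansiveD[OF assms] uv) auto
  also have "\<dots> \<le> norm (u - v)"
    by simp
  finally show "dist (average_op m T u) (average_op m T v) \<le> 1 * dist u v"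
    by (simp add: dist_norm)
qed simp

section \<open>The solution of the Cauchy problem\<close>

text \<open>
  Compactness of the trajectory over a bounded time interval provides the constant in all error
  bounds.
\<close>

lemma solution_residual_bound:
  fixes T :: "nat \<Rightarrow> 'a \<Rightarrow> 'a::real_normed_vector"
  assumes sol: "cauchy_solution D F y0 x"
    and T: "\<And>i. i \<in> {1..m} \<Longrightarrow> 1-lipschitz_on D (T i)"
  obtains K where "0 \<le> K" "\<And>i t. i \<in> {1..m} \<Longrightarrow> t \<in> {0..A} \<Longrightarrow> norm (T i (x t) - x t) \<le> K"
proof -
  have xc: "continuous_on {0..A} x" and xD: "x ` {0..A} \<subseteq> D"
    using sol by (auto simp: cauchy_solution_def intro: continuous_on_subset)
  have "continuous_on {0..A} (\<lambda>t. T i (x t))" if "i \<in> {1..m}" for i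
    using continuous_on_compose2[OF lipschitz_on_continuous_on[OF T[OF that]] xc xD] .
  then have "continuous_on {0..A} (\<lambda>t. \<Sum>i = 1..m. norm (T i (x t) - x t))"
    using xc by (intro continuous_intros) auto
  then have "bounded ((\<lambda>t. \<Sum>i = 1..m. norm (T i (x t) - x t)) ` {0..A})"
    by (intro compact_imp_bounded compact_continuous_image) auto
  then obtain K where K: "K > 0" "\<And>t. t \<in> {0..A} \<Longrightarrow> norm (\<Sum>i = 1..m. norm (T i (x t) - x t)) \<le> K"
    by (auto simp: bounded_pos)
  have "norm (T i (x t) - x t) \<le> K" if "i \<in> {1..m}" "t \<in> {0..A}" for i t
  proof -
    have "norm (T i (x t) - x t) \<le> (\<Sum>i = 1..m. norm (T i (x t) - x t))"
      using that by (intro member_le_sum) auto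
    then show ?thesis
      using K(2)[OF that(2)] by simp
  qed
  then show thesis
    using that K(1) by (metis less_imp_le)
qed

lemma average_op_residual_le:
  fixes T :: "nat \<Rightarrow> 'a \<Rightarrow> 'a::real_normed_vector"
  assumes "m > 0" "\<And>i. i \<in> {1..m} \<Longrightarrow> norm (T i v - v) \<le> K"
  shows "norm (average_op m T v - v) \<le> K"
proof -
  have "real m * norm (average_op m T v - v) = norm (\<Sum>i = 1..m. T i v - v)"
    using average_op_residual[OF assms(1), of T v] by (metis norm_scaleR abs_of_nat)
  also have "\<dots> \<le> (\<Sum>i = 1..m. K)"
    by (intro order_trans[OF norm_sum] sum_mono assms(2))
  finally show ?thesis
    using assms(1) by simp
qed

lemma solution_lipschitz:
  fixes x :: "real \<Rightarrow> 'a::real_inner"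
  assumes sol: "cauchy_solution D F y0 x" and "0 \<le> s" "s \<le> t" "t \<le> A"
    and bound: "\<And>t. t \<in> {0..A} \<Longrightarrow> norm (F (x t) - x t) \<le> K"
  shows "norm (x t - x s) \<le> K * (t - s)"
proof (cases "s = t")
  case False
  have "continuous_on {s..t} x"
    using sol assms by (auto simp: cauchy_solution_def intro: continuous_on_subset)
  moreover have "(x has_derivative (\<lambda>h. h *\<^sub>R (- (x r - F (x r))))) (at r)" if "s < r" "r < t" for r
    using sol that assms by (auto simp: cauchy_solution_def has_vector_derivative_def)
  ultimately obtain r where r: "r \<in> {s<..<t}"
    "norm (x t - x s) \<le> norm ((t - s) *\<^sub>R (- (x r - F (x r))))"
    using mvt_general[of s t x "\<lambda>r h. h *\<^sub>R (- (x r - F (x r)))"] False assms(3) by auto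
  have "norm ((t - s) *\<^sub>R (- (x r - F (x r)))) = (t - s) * norm (F (x r) - x r)"
    using assms(3) by simp
  also have "\<dots> \<le> (t - s) * K"
    using bound[of r] r(1) assms by (intro mult_left_mono) auto
  finally show ?thesis
    using r(2) by (simp add: mult.commute)
qed simp

text \<open>
  Along the step, the velocity \<open>F (x r) - x r\<close> differs from its initial value by at most
  \<open>2 K h\<close>, because the residual is 2-Lipschitz and \<open>x\<close> is \<open>K\<close>-Lipschitz.
\<close>

lemma solution_euler_error:
  fixes x :: "real \<Rightarrow> 'a::real_inner"
  assumes sol: "cauchy_solution D F y0 x" and F: "1-lipschitz_on D F"
    and "0 \<le> s" "0 < h" "s + h \<le> A" "0 \<le> K"
    and bound: "\<And>t. t \<in> {0..A} \<Longrightarrow> norm (F (x t) - x t) \<le> K"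
  shows "norm (x (s + h) - x s - h *\<^sub>R (F (x s) - x s)) \<le> 2 * h\<^sup>2 * K"
proof -
  let ?g = "\<lambda>t. x t - t *\<^sub>R (F (x s) - x s)"
  let ?g' = "\<lambda>r. (F (x r) - x r) - (F (x s) - x s)"
  have "continuous_on {s..s + h} x"
    using sol assms by (auto simp: cauchy_solution_def intro: continuous_on_subset)
  then have "continuous_on {s..s + h} ?g"
    by (intro continuous_intros)
  moreover have "(?g has_derivative (\<lambda>d. d *\<^sub>R ?g' r)) (at r)" if "s < r" "r < s + h" for r
  proof -
    have "(x has_vector_derivative - (x r - F (x r))) (at r)"
      using sol that assms by (auto simp: cauchy_solution_def)
    then have "(?g has_vector_derivative ?g' r) (at r)"
      by (auto intro!: derivative_eq_intros)
    then show ?thesis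
      by (simp add: has_vector_derivative_def)
  qed
  ultimately obtain r where r: "r \<in> {s<..<s + h}"
    "norm (?g (s + h) - ?g s) \<le> norm ((s + h - s) *\<^sub>R ?g' r)"
    using mvt_general[of s "s + h" ?g "\<lambda>r d. d *\<^sub>R ?g' r"] assms(4) by auto
  have "norm (?g' r) \<le> 2 * norm (x r - x s)"
    using sol r(1) assms(3) by (intro norm_residual_diff_le[OF F]) (auto simp: cauchy_solution_def)
  also have "\<dots> \<le> 2 * (K * (r - s))"
    using solution_lipschitz[OF sol _ _ _ bound, of s r A] r(1) assms by simp
  also have "\<dots> \<le> 2 * (K * h)"
    using r(1) assms(6) by (intro mult_left_mono) auto
  finally have "norm ((s + h - s) *\<^sub>R ?g' r) \<le> h * (2 * (K * h))"
    using assms(4) by simp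
  moreover have "?g (s + h) - ?g s = x (s + h) - x s - h *\<^sub>R (F (x s) - x s)"
    by (simp add: algebra_simps)
  ultimately show ?thesis
    using r(2) by (simp add: power2_eq_square algebra_simps)
qed

section \<open>Accumulation of errors and interpolation\<close>

text \<open>
  Stability enters here: the error of the previous iterate passes through the nonexpansive step
  without amplification, so only the local error of the step, taken at the exact solution, is added.
\<close>

lemma iterate_error:
  fixes R :: "'a \<Rightarrow> 'a::real_normed_vector"
  assumes R: "1-lipschitz_on D R" "R ` D \<subseteq> D" and "x 0 \<in> D" and "0 \<le> h"
    and xD: "\<And>t. 0 \<le> t \<Longrightarrow> x t \<in> D"
    and loc: "\<And>t. 0 \<le> t \<Longrightarrow> t + h \<le> A \<Longrightarrow> norm (R (x t) - x (t + h)) \<le> \<delta>"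
    and "real k * h \<le> A"
  shows "norm ((R ^^ k) (x 0) - x (real k * h)) \<le> real k * \<delta>"
  using assms(7)
proof (induction k)
  case 0
  show ?case by simp
next
  case (Suc k)
  have iter: "(R ^^ k) (x 0) \<in> D"
    by (induction k) (use R(2) assms(3) in auto)
  have eq: "real (Suc k) * h = real k * h + h"
    by (simp add: algebra_simps)
  have IH: "norm ((R ^^ k) (x 0) - x (real k * h)) \<le> real k * \<delta>"
    using Suc assms(4) eq by auto
  have "norm (R ((R ^^ k) (x 0)) - R (x (real k * h))) \<le> norm ((R ^^ k) (x 0) - x (real k * h))"
    using assms(4) by (intro nonexpansiveD[OF R(1) iter] xD) simp
  moreover have "norm (R (x (real k * h)) - x (real k * h + h)) \<le> \<delta>"
    using Suc.prems assms(4) eq by (intro loc) auto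
  moreover have "norm (R ((R ^^ k) (x 0)) - x (real k * h + h))
      \<le> norm (R ((R ^^ k) (x 0)) - R (x (real k * h))) + norm (R (x (real k * h)) - x (real k * h + h))"
    by (metis norm_triangle_ineq diff_add_cancel add_diff_eq)
  ultimately show ?case
    using IH eq by (simp add: algebra_simps)
qed

lemma norm_interpolate_diff_le:
  fixes a b c :: "'a::real_normed_vector"
  assumes "0 \<le> \<theta>" "\<theta> \<le> 1" "norm (a - c) \<le> C" "norm (b - c) \<le> C"
  shows "norm (a + \<theta> *\<^sub>R (b - a) - c) \<le> C"
proof -
  have "a + \<theta> *\<^sub>R (b - a) = (1 - \<theta>) *\<^sub>R a + \<theta> *\<^sub>R b"
    by (simp add: algebra_simps)
  also have "\<dots> \<in> cball c C"
    using assms by (intro convexD[OF convex_cball]) (auto simp: dist_norm norm_minus_commute)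
  finally show ?thesis
    by (simp add: dist_norm norm_minus_commute)
qed

text \<open>
  The time horizon is extended from \<open>tbar\<close> to \<open>tbar + m\<close> so that it contains the whole
  interpolation interval around any \<open>t \<le> tbar\<close>: the step length \<open>m \<epsilon>\<close> is at most \<open>m\<close>.
\<close>

lemma interpolation_error:
  fixes T :: "nat \<Rightarrow> 'a \<Rightarrow> 'a::real_inner"
  assumes D: "convex D" and m: "m > 0"
    and TD: "\<And>i. i \<in> {1..m} \<Longrightarrow> T i ` D \<subseteq> D"
    and T: "\<And>i. i \<in> {1..m} \<Longrightarrow> 1-lipschitz_on D (T i)"
    and sol: "cauchy_solution D (average_op m T) y0 x"
    and \<epsilon>: "0 < \<epsilon>" "\<epsilon> \<le> 1" and K: "0 \<le> K"
    and bound: "\<And>i t. i \<in> {1..m} \<Longrightarrow> t \<in> {0..tbar + real m} \<Longrightarrow> norm (T i (x t) - x t) \<le> K"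
    and t: "0 \<le> t" "t \<le> tbar"
    and tk: "real k * (real m * \<epsilon>) \<le> t" "t < (real k + 1) * (real m * \<epsilon>)"
  shows "norm ((cyclic_op m T \<epsilon> ^^ k) y0
      + ((t - real k * (real m * \<epsilon>)) / (real m * \<epsilon>)) *\<^sub>R
          ((cyclic_op m T \<epsilon> ^^ Suc k) y0 - (cyclic_op m T \<epsilon> ^^ k) y0) - x t)
    \<le> (3 * (tbar + real m) + 1) * K * real m * \<epsilon>"
proof -
  define h where "h = real m * \<epsilon>"
  define R where "R = cyclic_op m T \<epsilon>"
  define A where "A = tbar + real m"
  have h: "0 < h" "h \<le> real m"
    using m \<epsilon> by (auto simp: h_def mult_left_le)
  have x0: "x 0 = y0" and xD: "\<And>t. 0 \<le> t \<Longrightarrow> x t \<in> D"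
    using sol by (auto simp: cauchy_solution_def)
  have avg: "norm (average_op m T (x t) - x t) \<le> K" if "t \<in> {0..A}" for t
    using bound that by (intro average_op_residual_le[OF m]) (auto simp: A_def)
  have R: "1-lipschitz_on D R" "R ` D \<subseteq> D"
    unfolding R_def cyclic_op_def image_subset_iff
    by (intro ballI nonexpansive_fold_relaxed[OF D] fold_relaxed_mem[OF D] TD T; use \<epsilon> in force)+
  have loc: "norm (R (x s) - x (s + h)) \<le> 3 * h\<^sup>2 * K" if s: "0 \<le> s" "s + h \<le> A" for s
  proof -
    let ?E = "h *\<^sub>R (average_op m T (x s) - x s)"
    have "norm (R (x s) - x s - ?E) \<le> h\<^sup>2 * K"
      unfolding R_def h_def using s h \<epsilon>
      by (intro cyclic_op_euler_error[OF D TD T _ _ xD m bound K]) (auto simp: A_def)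
    moreover have "norm (x (s + h) - x s - ?E) \<le> 2 * h\<^sup>2 * K"
      by (rule solution_euler_error[OF sol nonexpansive_average_op[OF T] s(1) h(1) s(2) K avg])
    moreover have "R (x s) - x (s + h) = (R (x s) - x s - ?E) - (x (s + h) - x s - ?E)"
      by simp
    then have "norm (R (x s) - x (s + h))
        \<le> norm (R (x s) - x s - ?E) + norm (x (s + h) - x s - ?E)"
      by (metis norm_triangle_ineq4)
    ultimately show ?thesis by simp
  qed
  have eq: "real (Suc k) * h = real k * h + h"
    by (simp add: algebra_simps)
  have kh: "real k * h \<le> t" "t \<le> real (Suc k) * h"
    using tk by (simp_all add: h_def algebra_simps)
  have kA: "real (Suc k) * h \<le> A"
    using eq kh t h by (simp add: A_def)
  \<comment> \<open>Used below for both end points \<open>j h\<close> of the interpolation interval, which are within \<open>h\<close> of \<open>t\<close>.\<close>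
  have node: "norm ((R ^^ j) y0 - x t) \<le> 3 * A * K * h + K * h"
    if j: "real j * h \<le> A" "norm (x (real j * h) - x t) \<le> K * h" for j
  proof -
    have "norm ((R ^^ j) y0 - x (real j * h)) \<le> real j * (3 * h\<^sup>2 * K)"
      using iterate_error[where x = x, OF R _ _ xD loc j(1)] xD[of 0] h x0 by simp
    also have "\<dots> = 3 * (real j * h) * K * h"
      by (simp add: power2_eq_square)
    also have "\<dots> \<le> 3 * A * K * h"
      using j(1) h K by (intro mult_right_mono) auto
    finally show ?thesis
      using j(2) norm_triangle_ineq[of "(R ^^ j) y0 - x (real j * h)" "x (real j * h) - x t"]
      by simp
  qed
  have "norm (x t - x (real k * h)) \<le> K * (t - real k * h)"
    using h kh kA by (intro solution_lipschitz[OF sol _ _ _ avg]) auto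
  also have "\<dots> \<le> K * h"
    using kh eq K by (intro mult_left_mono) auto
  finally have 1: "norm ((R ^^ k) y0 - x t) \<le> 3 * A * K * h + K * h"
    using kA eq h by (intro node) (auto simp: norm_minus_commute)
  have "norm (x (real (Suc k) * h) - x t) \<le> K * (real (Suc k) * h - t)"
    using kh kA t by (intro solution_lipschitz[OF sol _ _ _ avg])
  also have "\<dots> \<le> K * h"
    using kh eq K by (intro mult_left_mono) auto
  finally have 2: "norm ((R ^^ Suc k) y0 - x t) \<le> 3 * A * K * h + K * h"
    using kA by (intro node)
  have "0 \<le> (t - real k * h) / h" "(t - real k * h) / h \<le> 1"
    using h kh eq by auto
  from norm_interpolate_diff_le[OF this 1 2] show ?thesis
    unfolding R_def[symmetric] h_def[symmetric] by (simp add: A_def h_def algebra_simps)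
qed

theorem proposition3p3:
  fixes D :: "'a::{real_inner, complete_space} set"
    and m :: nat
    and T :: "nat \<Rightarrow> 'a \<Rightarrow> 'a"
    and \<eta> \<beta> :: real
    and y0 :: 'a
    and x :: "real \<Rightarrow> 'a"
    and \<psi> :: "real \<Rightarrow> real \<Rightarrow> 'a"
  assumes "D \<noteq> {}" and "closed D" and "convex D"
    and "m \<ge> 2"
    and "\<And>i. i \<in> {1..m} \<Longrightarrow> T i ` D \<subseteq> D"
    and "\<And>i. i \<in> {1..m} \<Longrightarrow> 1-lipschitz_on D (T i)"
    and "0 < \<eta>" and "\<eta> \<le> 1" and "0 < \<beta>"
    and "\<And>\<epsilon>. \<epsilon> \<in> {0<..<\<eta>} \<Longrightarrow> \<exists>z \<in> Fix_on D (cyclic_op m T \<epsilon>). norm z \<le> \<beta>"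
    and "y0 \<in> D"
    and "cauchy_solution D (average_op m T) y0 x"
    and "\<And>\<epsilon> k t. \<epsilon> \<in> {0<..<\<eta>} \<Longrightarrow>
           t \<in> {real k * real m * \<epsilon> ..< (real k + 1) * real m * \<epsilon>} \<Longrightarrow>
           \<psi> \<epsilon> t = (cyclic_op m T \<epsilon> ^^ k) y0
             + ((t - real k * real m * \<epsilon>) / (real m * \<epsilon>)) *\<^sub>R
                 ((cyclic_op m T \<epsilon> ^^ Suc k) y0 - (cyclic_op m T \<epsilon> ^^ k) y0)"
  shows "\<forall>tbar>0. ((\<lambda>\<epsilon>. SUP t\<in>{0..tbar}. ereal (norm (\<psi> \<epsilon> t - x t))) \<longlongrightarrow> 0) (at_right 0)"
proof (intro allI impI)
  fix tbar :: real assume "tbar > 0"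
  have m: "m > 0" using \<open>m \<ge> 2\<close> by simp
  obtain K where K: "0 \<le> K"
    "\<And>i t. i \<in> {1..m} \<Longrightarrow> t \<in> {0..tbar + real m} \<Longrightarrow> norm (T i (x t) - x t) \<le> K"
    using solution_residual_bound[OF assms(12), where m = m and T = T and A = "tbar + real m"] assms(6)
    by blast
  define C where "C = (3 * (tbar + real m) + 1) * K * real m"
  have err: "norm (\<psi> \<epsilon> t - x t) \<le> C * \<epsilon>" if \<epsilon>: "\<epsilon> \<in> {0<..<\<eta>}" and t: "t \<in> {0..tbar}" for \<epsilon> t
  proof -
    define h where "h = real m * \<epsilon>"
    define k where "k = nat \<lfloor>t / h\<rfloor>"
    have h: "h > 0" using m \<epsilon> by (simp add: h_def)
    have "real k \<le> t / h" "t / h < real k + 1"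
      using h t by (auto simp: k_def)
    then have tk: "real k * h \<le> t" "t < (real k + 1) * h"
      using h by (simp_all add: field_simps)
    then have "t \<in> {real k * real m * \<epsilon> ..< (real k + 1) * real m * \<epsilon>}"
      by (simp add: h_def mult.assoc)
    from assms(13)[OF \<epsilon> this]
    have "\<psi> \<epsilon> t = (cyclic_op m T \<epsilon> ^^ k) y0 + ((t - real k * (real m * \<epsilon>)) / (real m * \<epsilon>)) *\<^sub>R
        ((cyclic_op m T \<epsilon> ^^ Suc k) y0 - (cyclic_op m T \<epsilon> ^^ k) y0)"
      by (simp add: mult.assoc)
    moreover have "0 < \<epsilon>" "\<epsilon> \<le> 1" "0 \<le> t" "t \<le> tbar"
      using \<epsilon> t \<open>\<eta> \<le> 1\<close> by auto
    ultimately show ?thesis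
      using interpolation_error[OF assms(3) m assms(5,6,12) _ _ K, where \<epsilon> = \<epsilon> and t = t and k = k and tbar = tbar] tk
      by (simp add: C_def h_def)
  qed
  have small: "\<forall>\<^sub>F \<epsilon> in at_right 0. \<epsilon> \<in> {0<..<\<eta>}"
    using \<open>0 < \<eta>\<close> by (auto simp: eventually_at_right_field)
  show "((\<lambda>\<epsilon>. SUP t\<in>{0..tbar}. ereal (norm (\<psi> \<epsilon> t - x t))) \<longlongrightarrow> 0) (at_right 0)"
  proof (rule tendsto_sandwich)
    show "\<forall>\<^sub>F \<epsilon> in at_right 0. 0 \<le> (SUP t\<in>{0..tbar}. ereal (norm (\<psi> \<epsilon> t - x t)))"
      using \<open>tbar > 0\<close> by (intro always_eventually allI SUP_upper2[of 0]) auto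
    show "\<forall>\<^sub>F \<epsilon> in at_right 0. (SUP t\<in>{0..tbar}. ereal (norm (\<psi> \<epsilon> t - x t))) \<le> ereal (C * \<epsilon>)"
      using small by eventually_elim (auto intro!: SUP_least err)
    have "((\<lambda>\<epsilon>. C * \<epsilon>) \<longlongrightarrow> C * 0) (at_right 0)"
      by (intro tendsto_intros)
    then show "((\<lambda>\<epsilon>. ereal (C * \<epsilon>)) \<longlongrightarrow> 0) (at_right 0)"
      by (simp add: zero_ereal_def)
  qed simp
qed

end
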